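(* Assume the continuum hypothesis, and let $\kappa$ be an infinite cardinal. Then $l^\infty(\kappa)$ and $B(l^2(\kappa))$ have regular singular states if and only if $\kappa$ is Ulam measurable.
   Context: A cardinal $\kappa$ is Ulam measurable if there is a nonzero countably additive $\{0,1\}$-valued measure on all subsets of $\kappa$ vanishing on singletons. A state $\phi$ on a von Neumann algebra is regular if $\phi(q_n)=0$ for all $n$ implies $\phi(\bigvee q_n)=0$ for any countable set of projections $\{q_n\}$. A state on $l^\infty(\kappa)$ is singular if it vanishes on finitely supported functions; on $B(l^2(\kappa))$, if it vanishes on the compact operators. *)

theory Defs
  imports "HOL-Analysis.Analysis" "HOL-Library.Equipollence"
begin

definition continuum_hypothesis :: bool where
  "continuum_hypothesis \<longleftrightarrow> (\<forall>S :: real set. countable S \<or> S \<approx> (UNIV :: real set))"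

text \<open>The cardinal kappa is represented by the type 'a (kappa = card of UNIV :: 'a set).
  Ulam measurable: there is a nonzero countably additive {0,1}-valued measure
  on all subsets of 'a vanishing on singletons.\<close>
definition ulam_measurable :: "'a itself \<Rightarrow> bool" where
  "ulam_measurable _ \<longleftrightarrow>
     (\<exists>\<mu> :: 'a set \<Rightarrow> real.
        (\<forall>A. \<mu> A = 0 \<or> \<mu> A = 1) \<and>
        (\<exists>A. \<mu> A \<noteq> 0) \<and>
        (\<forall>x. \<mu> {x} = 0) \<and>
        (\<forall>A :: nat \<Rightarrow> 'a set. disjoint_family A \<longrightarrow> (\<lambda>n. \<mu> (A n)) sums \<mu> (\<Union>n. A n)))"

definition cnonneg :: "complex \<Rightarrow> bool" where
  "cnonneg z \<longleftrightarrow> Im z = 0 \<and> 0 \<le> Re z"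

definition linf :: "('a \<Rightarrow> complex) set" where
  "linf = {f. bounded (range f)}"

definition linf_state :: "(('a \<Rightarrow> complex) \<Rightarrow> complex) \<Rightarrow> bool" where
  "linf_state \<phi> \<longleftrightarrow>
     (\<forall>f\<in>linf. \<forall>g\<in>linf. \<phi> (\<lambda>i. f i + g i) = \<phi> f + \<phi> g) \<and>
     (\<forall>c. \<forall>f\<in>linf. \<phi> (\<lambda>i. c * f i) = c * \<phi> f) \<and>
     (\<forall>f\<in>linf. (\<forall>i. cnonneg (f i)) \<longrightarrow> cnonneg (\<phi> f)) \<and>
     \<phi> (\<lambda>_. 1) = 1"

definition linf_proj :: "('a \<Rightarrow> complex) \<Rightarrow> bool" where
  "linf_proj p \<longleftrightarrow> p \<in> linf \<and> (\<forall>i. p i * p i = p i \<and> cnj (p i) = p i)"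

definition linf_proj_le :: "('a \<Rightarrow> complex) \<Rightarrow> ('a \<Rightarrow> complex) \<Rightarrow> bool" where
  "linf_proj_le p q \<longleftrightarrow> (\<forall>i. q i * p i = p i)"

definition linf_proj_sup :: "(nat \<Rightarrow> 'a \<Rightarrow> complex) \<Rightarrow> ('a \<Rightarrow> complex) \<Rightarrow> bool" where
  "linf_proj_sup q P \<longleftrightarrow> linf_proj P \<and> (\<forall>n. linf_proj_le (q n) P) \<and>
     (\<forall>R. linf_proj R \<longrightarrow> (\<forall>n. linf_proj_le (q n) R) \<longrightarrow> linf_proj_le P R)"

definition linf_regular :: "(('a \<Rightarrow> complex) \<Rightarrow> complex) \<Rightarrow> bool" where
  "linf_regular \<phi> \<longleftrightarrow>
     (\<forall>q :: nat \<Rightarrow> 'a \<Rightarrow> complex. (\<forall>n. linf_proj (q n)) \<longrightarrow> (\<forall>n. \<phi> (q n) = 0) \<longrightarrow>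
        (\<forall>P. linf_proj_sup q P \<longrightarrow> \<phi> P = 0))"

definition linf_singular :: "(('a \<Rightarrow> complex) \<Rightarrow> complex) \<Rightarrow> bool" where
  "linf_singular \<phi> \<longleftrightarrow> (\<forall>f. finite {i. f i \<noteq> 0} \<longrightarrow> \<phi> f = 0)"

definition l2 :: "('a \<Rightarrow> complex) set" where
  "l2 = {f. (\<lambda>i. (cmod (f i))\<^sup>2) summable_on UNIV}"

definition l2_norm :: "('a \<Rightarrow> complex) \<Rightarrow> real" where
  "l2_norm f = sqrt (\<Sum>\<^sub>\<infinity>i. (cmod (f i))\<^sup>2)"

definition l2_inner :: "('a \<Rightarrow> complex) \<Rightarrow> ('a \<Rightarrow> complex) \<Rightarrow> complex" where
  "l2_inner f g = (\<Sum>\<^sub>\<infinity>i. cnj (f i) * g i)"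

text \<open>Bounded operators on l2, represented as functions on 'a \<Rightarrow> complex that
  are linear and bounded on l2, map l2 into l2 and are normalized to 0 outside l2
  (so that each bounded operator has exactly one representative).\<close>
type_synonym 'a op = "('a \<Rightarrow> complex) \<Rightarrow> ('a \<Rightarrow> complex)"

definition bop :: "'a op set" where
  "bop = {T. (\<forall>x\<in>l2. T x \<in> l2) \<and>
             (\<forall>x\<in>l2. \<forall>y\<in>l2. T (\<lambda>i. x i + y i) = (\<lambda>i. T x i + T y i)) \<and>
             (\<forall>c. \<forall>x\<in>l2. T (\<lambda>i. c * x i) = (\<lambda>i. c * T x i)) \<and>
             (\<exists>K. \<forall>x\<in>l2. l2_norm (T x) \<le> K * l2_norm x) \<and>
             (\<forall>x. x \<notin> l2 \<longrightarrow> T x = (\<lambda>_. 0))}"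

definition op_id :: "'a op" where
  "op_id x = (if x \<in> l2 then x else (\<lambda>_. 0))"

definition op_add :: "'a op \<Rightarrow> 'a op \<Rightarrow> 'a op" where
  "op_add S T = (\<lambda>x i. S x i + T x i)"

definition op_scale :: "complex \<Rightarrow> 'a op \<Rightarrow> 'a op" where
  "op_scale c T = (\<lambda>x i. c * T x i)"

definition op_positive :: "'a op \<Rightarrow> bool" where
  "op_positive T \<longleftrightarrow> T \<in> bop \<and> (\<forall>x\<in>l2. cnonneg (l2_inner x (T x)))"

definition bop_state :: "('a op \<Rightarrow> complex) \<Rightarrow> bool" where
  "bop_state \<phi> \<longleftrightarrow>
     (\<forall>S\<in>bop. \<forall>T\<in>bop. \<phi> (op_add S T) = \<phi> S + \<phi> T) \<and>
     (\<forall>c. \<forall>T\<in>bop. \<phi> (op_scale c T) = c * \<phi> T) \<and>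
     (\<forall>T. op_positive T \<longrightarrow> cnonneg (\<phi> T)) \<and>
     \<phi> op_id = 1"

definition op_proj :: "'a op \<Rightarrow> bool" where
  "op_proj P \<longleftrightarrow> P \<in> bop \<and> P \<circ> P = P \<and>
     (\<forall>x\<in>l2. \<forall>y\<in>l2. l2_inner (P x) y = l2_inner x (P y))"

definition op_proj_le :: "'a op \<Rightarrow> 'a op \<Rightarrow> bool" where
  "op_proj_le P Q \<longleftrightarrow> Q \<circ> P = P"

definition op_proj_sup :: "(nat \<Rightarrow> 'a op) \<Rightarrow> 'a op \<Rightarrow> bool" where
  "op_proj_sup q P \<longleftrightarrow> op_proj P \<and> (\<forall>n. op_proj_le (q n) P) \<and>
     (\<forall>R. op_proj R \<longrightarrow> (\<forall>n. op_proj_le (q n) R) \<longrightarrow> op_proj_le P R)"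

definition bop_regular :: "('a op \<Rightarrow> complex) \<Rightarrow> bool" where
  "bop_regular \<phi> \<longleftrightarrow>
     (\<forall>q :: nat \<Rightarrow> 'a op. (\<forall>n. op_proj (q n)) \<longrightarrow> (\<forall>n. \<phi> (q n) = 0) \<longrightarrow>
        (\<forall>P. op_proj_sup q P \<longrightarrow> \<phi> P = 0))"

text \<open>Compact operator: the image of the closed unit ball is relatively compact,
  i.e. (l2 being complete) totally bounded in the l2 norm.\<close>
definition op_compact :: "'a op \<Rightarrow> bool" where
  "op_compact T \<longleftrightarrow> T \<in> bop \<and>
     (\<forall>e>0. \<exists>F. finite F \<and> F \<subseteq> l2 \<and>
        (\<forall>x\<in>l2. l2_norm x \<le> 1 \<longrightarrow> (\<exists>y\<in>F. l2_norm (\<lambda>i. T x i - y i) < e)))"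

definition bop_singular :: "('a op \<Rightarrow> complex) \<Rightarrow> bool" where
  "bop_singular \<phi> \<longleftrightarrow> (\<forall>T. op_compact T \<longrightarrow> \<phi> T = 0)"

end

theory Submission
  imports Defs
begin

text \<open>
  A regular singular state, evaluated on (diagonal) projections, is a finitely additive probability
  measure on all subsets of \<open>\<kappa>\<close> whose null sets form a \<open>\<sigma>\<close>-ideal containing the singletons. If it has
  an atom, then it is two-valued there, and \<open>\<kappa>\<close> is Ulam measurable. Otherwise, cut the space repeatedly
  into two pieces, always choosing the smaller piece almost as large as possible. The pieces along a
  branch of the resulting binary tree intersect in a null set: a split of a positive intersection
  would bound from below the mass lost at every step. This gives a map to the reals with null
  fibres, and pushing forward yields such a measure on the reals. Under the continuum hypothesis the
  Ulam matrix then produces uncountably many disjoint positive sets, which is absurd.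

  Conversely, a countably complete free ultrafilter makes every complex function constant almost
  everywhere, and the states \<open>f \<mapsto> lim f(i)\<close> and \<open>T \<mapsto> lim \<langle>e\<^sub>i, T e\<^sub>i\<rangle>\<close> are regular and singular.
\<close>

section \<open>Charges whose null sets form a sigma-ideal\<close>

text \<open>Countable additivity is not among the axioms: regularity of a state speaks only about
  projections of value 0, and \<open>null_UN\<close> is what it yields.\<close>

locale null_sigma_charge =
  fixes m :: "'a set \<Rightarrow> real"
  assumes nonneg: "0 \<le> m A"
    and total: "m UNIV = 1"
    and additive: "A \<inter> B = {} \<Longrightarrow> m (A \<union> B) = m A + m B"
    and singleton: "m {x} = 0"
    and null_UN: "(\<And>n. m (C n) = 0) \<Longrightarrow> m (\<Union>n::nat. C n) = 0"
begin

lemma empty: "m {} = 0"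
  using additive[of "{}" "{}"] by simp

lemma diff: "B \<subseteq> A \<Longrightarrow> m (A - B) = m A - m B"
  using additive[of "A - B" B] by (simp add: Un_absorb2 Int_commute)

lemma mono: "A \<subseteq> B \<Longrightarrow> m A \<le> m B"
  using diff[of A B] nonneg[of "B - A"] by simp

lemma le_one: "m A \<le> 1"
  using mono[of A UNIV] total by simp

lemma null_subset: "A \<subseteq> B \<Longrightarrow> m B = 0 \<Longrightarrow> m A = 0"
  using mono[of A B] nonneg[of A] by simp

lemma countable_null:
  assumes "countable A"
  shows "m A = 0"
proof (cases "A = {}")
  case False
  have "m (\<Union>n. {from_nat_into A n}) = 0"
    by (rule null_UN) (rule singleton)
  moreover have "(\<Union>n. {from_nat_into A n}) = A"
    using range_from_nat_into[OF False assms] by auto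
  ultimately show ?thesis by simp
qed (simp add: empty)

lemma finite_UN:
  assumes "finite I" "disjoint_family_on A I"
  shows "m (\<Union>i\<in>I. A i) = (\<Sum>i\<in>I. m (A i))"
  using assms
proof (induction I rule: finite_induct)
  case (insert j I)
  have "A j \<inter> (\<Union>i\<in>I. A i) = {}"
    using insert by (auto simp: disjoint_family_on_def)
  moreover have "disjoint_family_on A I"
    using insert.prems by (auto simp: disjoint_family_on_def)
  ultimately show ?case
    using insert additive by simp
qed (simp add: empty)

text \<open>Finite partial sums of the masses are bounded by 1, so the masses are summable, and a
  summable family has countable support.\<close>

lemma countable_positive_disjoint:
  assumes "disjoint_family_on A I"
  shows "countable {i \<in> I. m (A i) \<noteq> 0}"
proof -
  have "(\<lambda>i. m (A i)) summable_on I"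
  proof (rule nonneg_bdd_above_summable_on)
    show "bdd_above (sum (\<lambda>i. m (A i)) ` {F. F \<subseteq> I \<and> finite F})"
    proof (rule bdd_aboveI2)
      fix F assume "F \<in> {F. F \<subseteq> I \<and> finite F}"
      then have "(\<Sum>i\<in>F. m (A i)) = m (\<Union>i\<in>F. A i)"
        using finite_UN[of F A] assms disjoint_family_on_mono[of F I A] by auto
      then show "(\<Sum>i\<in>F. m (A i)) \<le> 1"
        using le_one by simp
    qed
  qed (rule nonneg)
  then show ?thesis
    by (intro Infinite_Sum.abs_summable_countable) (simp add: nonneg)
qed

lemma null_sigma_charge_vimage:
  assumes "\<And>y. m (f -` {y}) = 0"
  shows "null_sigma_charge (\<lambda>Y. m (f -` Y))"
proof
  show "m (f -` (A \<union> B)) = m (f -` A) + m (f -` B)" if "A \<inter> B = {}" for A B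
    using that additive[of "f -` A" "f -` B"] by (simp add: vimage_Un flip: vimage_Int)
  show "m (f -` (\<Union>n. C n)) = 0" if "\<And>n::nat. m (f -` C n) = 0" for C
    unfolding vimage_UN using that by (rule null_UN)
qed (simp_all add: nonneg total assms)

section \<open>Atomless charges and binary splitting\<close>

text \<open>The supremum of the smaller mass over all splits of \<open>A\<close> may not be
  attained. If it is positive, some split exceeds half of it; if it is 0, the trivial split will
  do.\<close>

lemma near_optimal_split:
  obtains S where "S \<subseteq> A" "\<And>B. B \<subseteq> A \<Longrightarrow> min (m B) (m (A - B)) \<le> 2 * min (m S) (m (A - S))"
proof -
  define q where "q B = min (m B) (m (A - B))" for B
  have bdd: "bdd_above (q ` Pow A)"
    by (rule bdd_aboveI2[of _ _ 1]) (auto simp: q_def min.coboundedI1 le_one)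
  show thesis
  proof (cases "\<exists>B\<subseteq>A. q B > 0")
    case True
    then obtain B where B: "B \<subseteq> A" "q B > 0" by blast
    then have "q B \<le> Sup (q ` Pow A)"
      by (intro cSup_upper bdd) auto
    then have "Sup (q ` Pow A) / 2 < Sup (q ` Pow A)"
      using B by simp
    then obtain S where S: "S \<subseteq> A" "Sup (q ` Pow A) / 2 < q S"
      using less_cSup_iff[OF _ bdd, of "Sup (q ` Pow A) / 2"] by blast
    have "q B \<le> 2 * q S" if "B \<subseteq> A" for B
      using cSup_upper[OF _ bdd, of "q B"] S that by force
    with S that show thesis by (simp add: q_def)
  next
    case False
    then have "q B \<le> 2 * q {}" if "B \<subseteq> A" for B
      using that by (auto simp: q_def empty nonneg not_less min_def)
    with that[of "{}"] show thesis by (simp add: q_def)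
  qed
qed

lemma atomless_null_fibres:
  assumes atomless: "\<And>A. m A > 0 \<Longrightarrow> \<exists>B\<subseteq>A. m B > 0 \<and> m (A - B) > 0"
  obtains f :: "'a \<Rightarrow> nat set" where "\<And>y. m (f -` {y}) = 0"
proof -
  obtain S where S: "\<And>A. S A \<subseteq> A"
    "\<And>A B. B \<subseteq> A \<Longrightarrow> min (m B) (m (A - B)) \<le> 2 * min (m (S A)) (m (A - S A))"
  proof -
    have "\<forall>A. \<exists>S. S \<subseteq> A \<and> (\<forall>B\<subseteq>A. min (m B) (m (A - B)) \<le> 2 * min (m S) (m (A - S)))"
      by (rule allI, rule near_optimal_split) blast
    from choice[OF this] show thesis using that by blast
  qed
  \<comment> \<open>\<open>N x n\<close> is the node at level \<open>n\<close> of the splitting tree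
    that contains \<open>x\<close>; \<open>f x\<close> below records the turns of the branch through
    \<open>x\<close>.\<close>
  define N where "N x = rec_nat UNIV (\<lambda>_ A. if x \<in> S A then S A else A - S A)" for x
  have N0: "N x 0 = UNIV" for x by (simp add: N_def)
  have NSuc: "N x (Suc n) = (if x \<in> S (N x n) then S (N x n) else N x n - S (N x n))" for x n
    by (simp add: N_def)
  define f where "f x = {n. x \<in> S (N x n)}" for x
  have mem: "x \<in> N x n" for x n
    by (induction n) (auto simp: N0 NSuc)
  have N_eq: "N x n = N y n" if "f x = f y" for x y n
  proof (induction n)
    case (Suc n)
    moreover have "x \<in> S (N x n) \<longleftrightarrow> y \<in> S (N y n)"
      using that by (auto simp: f_def set_eq_iff)
    ultimately show ?case by (simp add: NSuc)
  qed (simp add: N0)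
  have "m (f -` {y}) = 0" for y
  proof (rule ccontr)
    define C where "C = f -` {y}"
    assume "m (f -` {y}) \<noteq> 0"
    then have "m C > 0" using nonneg[of C] by (simp add: C_def)
    then obtain B where B: "B \<subseteq> C" "m B > 0" "m (C - B) > 0"
      using atomless by blast
    \<comment> \<open>\<open>d\<close> does not depend on \<open>n\<close>: the split of
      \<open>C\<close> by \<open>B\<close> competes at every node of the branch, since all these
      nodes contain \<open>C\<close>.\<close>
    define d where "d = min (m B) (m (C - B))"
    have "d > 0" using B by (simp add: d_def)
    obtain x where x: "x \<in> C" using \<open>m C > 0\<close> empty by fastforce
    have CN: "C \<subseteq> N x n" for n
    proof
      fix z assume "z \<in> C"
      then have "f z = f x" using x by (simp add: C_def)
      then show "z \<in> N x n" using mem[of z n] N_eq by metis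
    qed
    have step: "m (N x (Suc n)) \<le> m (N x n) - d / 2" for n
    proof -
      have "C - B \<subseteq> N x n - B" using CN by blast
      then have "d \<le> min (m B) (m (N x n - B))"
        using mono[of "C - B" "N x n - B"] by (simp add: d_def min.coboundedI2)
      also have "\<dots> \<le> 2 * min (m (S (N x n))) (m (N x n - S (N x n)))"
        using S(2) B(1) CN by blast
      \<comment> \<open>Both pieces have mass at least \<open>d / 2\<close>, so whichever one the
        branch keeps, at least \<open>d / 2\<close> is discarded.\<close>
      finally have "d / 2 \<le> m (S (N x n))" "d / 2 \<le> m (N x n - S (N x n))" by auto
      then show ?thesis
        using diff[OF S(1), of "N x n"] by (simp add: NSuc)
    qed
    have bound: "m (N x n) \<le> 1 - real n * (d / 2)" for n
    proof (induction n)
      case (Suc n)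
      then show ?case using step[of n] by (simp add: field_simps)
    qed (simp add: N0 total)
    obtain n where "1 < real n * (d / 2)"
      using \<open>d > 0\<close> reals_Archimedean3[of "d / 2"] by (meson half_gt_zero)
    then show False using bound[of n] nonneg[of "N x n"] by simp
  qed
  then show thesis by (rule that)
qed

text \<open>Inside an atom, a set of positive mass has null complement. Hence at most one member of
  a disjoint family is positive there, which turns closure of the null sets under countable unions
  into countable additivity.\<close>

lemma atom_imp_ulam_measurable:
  assumes A: "m A > 0" and atom: "\<And>B. B \<subseteq> A \<Longrightarrow> m B = 0 \<or> m (A - B) = 0"
  shows "ulam_measurable TYPE('a)"
proof -
  define \<mu> :: "'a set \<Rightarrow> real" where "\<mu> B = (if m (A \<inter> B) = 0 then 0 else 1)" for B
  have "(\<lambda>n. \<mu> (B n)) sums \<mu> (\<Union>n. B n)" if disj: "disjoint_family B" for B :: "nat \<Rightarrow> 'a set"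
  proof (cases "\<exists>k. m (A \<inter> B k) \<noteq> 0")
    case True
    then obtain k where k: "m (A \<inter> B k) \<noteq> 0" by blast
    then have "m (A - A \<inter> B k) = 0" using atom[of "A \<inter> B k"] by auto
    moreover have "A \<inter> B n \<subseteq> A - A \<inter> B k" if "n \<noteq> k" for n
      using disj that by (auto simp: disjoint_family_on_def)
    ultimately have "\<mu> (B n) = 0" if "n \<noteq> k" for n
      using null_subset that unfolding \<mu>_def by metis
    moreover have "\<mu> (\<Union>n. B n) = 1"
      using k null_subset[of "A \<inter> B k" "A \<inter> (\<Union>n. B n)"] by (auto simp: \<mu>_def)
    moreover have "\<mu> (B k) = 1" using k by (simp add: \<mu>_def)
    ultimately show ?thesis
      using sums_finite[of "{k}" "\<lambda>n. \<mu> (B n)"] by simp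
  next
    case False
    then have "m (\<Union>n. A \<inter> B n) = 0" by (intro null_UN) auto
    then have "\<mu> (\<Union>n. B n) = 0" by (simp add: \<mu>_def)
    with False show ?thesis by (simp add: \<mu>_def)
  qed
  moreover have "\<mu> A \<noteq> 0" using A by (simp add: \<mu>_def)
  moreover have "\<mu> {x} = 0" for x
    using null_subset[OF _ singleton[of x], of "A \<inter> {x}"] by (simp add: \<mu>_def)
  moreover have "\<mu> B = 0 \<or> \<mu> B = 1" for B by (simp add: \<mu>_def)
  ultimately show ?thesis unfolding ulam_measurable_def by blast
qed

end

section \<open>The continuum hypothesis and the Ulam matrix\<close>

text \<open>In a well-order of the reals of least possible type, a proper initial segment is not
  equipollent to the reals, hence countable by the hypothesis.\<close>

lemma continuum_hypothesis_order:
  assumes continuum_hypothesis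
  obtains r :: "real rel" where "\<And>a. countable {b. (b, a) \<in> r}"
    "\<And>a b. (a, b) \<in> r \<or> (b, a) \<in> r"
proof -
  let ?c = "card_of (UNIV :: real set)"
  have total: "(a, b) \<in> ?c \<or> (b, a) \<in> ?c" for a b
  proof -
    have "Linear_order ?c" "Field ?c = UNIV"
      using card_of_Well_order[of "UNIV :: real set"] Field_card_of[of "UNIV :: real set"]
      by (auto simp: well_order_on_def)
    then show ?thesis
      by (cases "a = b") (auto simp: order_on_defs total_on_def refl_on_def)
  qed
  have "countable {b. (b, a) \<in> ?c}" for a
  proof -
    have "ordLess2 (card_of (underS ?c a)) ?c"
      by (rule card_of_underS) (use card_of_Card_order in \<open>auto simp: Field_card_of\<close>)
    then have "\<not> underS ?c a \<approx> (UNIV :: real set)"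
      using not_ordLess_ordIso by (metis card_of_ordIso eqpoll_def)
    then have "countable (underS ?c a)"
      using assms unfolding continuum_hypothesis_def by blast
    then have "countable (insert a (underS ?c a))" by simp
    then show ?thesis
      by (rule countable_subset[rotated]) (auto simp: underS_def)
  qed
  with total that show thesis by blast
qed

text \<open>The sets \<open>A n b\<close> below form the Ulam matrix: they are disjoint for fixed \<open>n\<close> and cover
  all but countably many points for fixed \<open>b\<close>.\<close>

lemma continuum_hypothesis_no_charge_real:
  assumes continuum_hypothesis
  shows "\<not> null_sigma_charge (m :: real set \<Rightarrow> real)"
proof
  assume "null_sigma_charge m"
  then interpret null_sigma_charge m .
  obtain r :: "real rel" where r: "\<And>a. countable {b. (b, a) \<in> r}"
    and total_r: "\<And>a b. (a, b) \<in> r \<or> (b, a) \<in> r"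
    using continuum_hypothesis_order[OF assms] by blast
  define g where "g a = to_nat_on {b. (b, a) \<in> r}" for a
  have inj: "inj_on (g a) {b. (b, a) \<in> r}" for a
    unfolding g_def by (rule inj_on_to_nat_on[OF r])
  define A where "A n b = {a. (b, a) \<in> r \<and> g a b = n}" for n b
  \<comment> \<open>The sets \<open>A n b\<close> cover everything above \<open>b\<close>; what they
    miss lies below \<open>b\<close> and is countable, hence null. They cannot all be null.\<close>
  have "\<exists>n. m (A n b) \<noteq> 0" for b
  proof (rule ccontr)
    assume "\<not> ?thesis"
    then have "m (\<Union>n. A n b) = 0" by (intro null_UN) auto
    moreover have "- (\<Union>n. A n b) \<subseteq> {a. (a, b) \<in> r}"
      using total_r by (auto simp: A_def)
    then have "m (- (\<Union>n. A n b)) = 0"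
      using countable_null r countable_subset by blast
    ultimately show False
      using additive[of "\<Union>n. A n b" "- (\<Union>n. A n b)"] total
      by (simp only: Compl_disjoint Compl_partition) simp
  qed
  then have "(\<Union>n. {b. m (A n b) \<noteq> 0}) = (UNIV :: real set)" by auto
  moreover have "countable {b. m (A n b) \<noteq> 0}" for n
  proof -
    have "disjoint_family_on (A n) UNIV"
      \<comment> \<open>A common point \<open>a\<close> of \<open>A n b\<close> and
        \<open>A n c\<close> gives \<open>b\<close> and \<open>c\<close> the same index
        \<open>n\<close> under the injective \<open>g a\<close>.\<close>
      using inj by (fastforce simp: A_def disjoint_family_on_def inj_on_def)
    then show ?thesis
      using countable_positive_disjoint[of "A n" UNIV] by simp
  qed
  then have "countable (\<Union>n. {b. m (A n b) \<noteq> 0})" by blast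
  ultimately show False using uncountable_UNIV_real by simp
qed

text \<open>Without an Ulam measure there is no atom, so a map with null fibres would push the
  charge forward to the reals, where none exists.\<close>

lemma (in null_sigma_charge) continuum_hypothesis_imp_ulam_measurable:
  assumes continuum_hypothesis
  shows "ulam_measurable TYPE('a)"
proof (rule ccontr)
  assume not_ulam: "\<not> ?thesis"
  have "\<exists>B\<subseteq>A. m B > 0 \<and> m (A - B) > 0" if "m A > 0" for A
  proof -
    obtain B where "B \<subseteq> A" "m B \<noteq> 0" "m (A - B) \<noteq> 0"
      using atom_imp_ulam_measurable[OF \<open>m A > 0\<close>] not_ulam by blast
    then show ?thesis
      using nonneg[of B] nonneg[of "A - B"] by (intro exI[of _ B]) simp
  qed
  then obtain f :: "'a \<Rightarrow> nat set" where f: "\<And>y. m (f -` {y}) = 0"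
    using atomless_null_fibres by metis
  obtain h :: "nat set \<Rightarrow> real" where h: "inj h"
    using nat_sets_eqpoll_reals by (auto simp: eqpoll_def bij_betw_def)
  have "m ((h \<circ> f) -` {y}) = 0" for y
  proof (cases "y \<in> range h")
    case True
    then obtain z where "y = h z" by blast
    then have "(h \<circ> f) -` {y} = f -` {z}" using h by (auto simp: inj_def)
    then show ?thesis by (simp add: f)
  next
    case False
    then have "(h \<circ> f) -` {y} = {}" by auto
    then show ?thesis by (simp only: empty)
  qed
  then show False
    using null_sigma_charge_vimage continuum_hypothesis_no_charge_real[OF assms] by blast
qed

section \<open>Limits along countably complete ultrafilters\<close>

text \<open>This is the "almost everywhere" quantifier of an Ulam measure: the filter stands for the
  sets of measure 1.\<close>

locale countably_complete_ultrafilter =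
  fixes F :: "'a filter"
  assumes nontrivial: "F \<noteq> bot"
    and ultra: "eventually P F \<or> eventually (\<lambda>x. \<not> P x) F"
    and all_nat: "(\<And>n::nat. eventually (Q n) F) \<Longrightarrow> eventually (\<lambda>x. \<forall>n. Q n x) F"
    and free: "eventually (\<lambda>x. x \<noteq> a) F"
begin

lemma ball_countable:
  assumes "countable I" "\<And>i. i \<in> I \<Longrightarrow> eventually (P i) F"
  shows "eventually (\<lambda>x. \<forall>i\<in>I. P i x) F"
proof (cases "I = {}")
  case False
  have "eventually (\<lambda>x. \<forall>n. P (from_nat_into I n) x) F"
    by (intro all_nat assms(2) from_nat_into[OF False])
  then show ?thesis
    by eventually_elim (metis assms(1) from_nat_into_surj)
qed simp

lemma not_in_countable: "countable A \<Longrightarrow> eventually (\<lambda>x. x \<notin> A) F"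
  using ball_countable[of A "\<lambda>a x. x \<noteq> a"] free by (auto elim!: eventually_mono)

text \<open>The ultrafilter decides membership of \<open>f x\<close> in each basic open set, and by
  countable completeness in all of them at once. Values at two points of the resulting large set
  cannot be separated, so they agree.\<close>

lemma eventually_constant:
  fixes f :: "'a \<Rightarrow> 'b :: {second_countable_topology, t2_space}"
  shows "\<exists>c. eventually (\<lambda>x. f x = c) F"
proof -
  obtain \<B> :: "'b set set" where \<B>: "countable \<B>" "topological_basis \<B>"
    using ex_countable_basis by blast
  define V where "V B = eventually (\<lambda>x. f x \<in> B) F" for B
  have "eventually (\<lambda>x. f x \<in> B \<longleftrightarrow> V B) F" for B
    using ultra[of "\<lambda>x. f x \<in> B"] by (cases "V B") (auto simp: V_def)
  then have ev: "eventually (\<lambda>x. \<forall>B\<in>\<B>. f x \<in> B \<longleftrightarrow> V B) F"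
    by (intro ball_countable \<B>)
  then obtain x where x: "\<forall>B\<in>\<B>. f x \<in> B \<longleftrightarrow> V B"
    using eventually_happens'[OF nontrivial] by blast
  have "eventually (\<lambda>y. f y = f x) F"
    using ev
  proof eventually_elim
    case (elim y)
    show ?case
    proof (rule ccontr)
      assume "f y \<noteq> f x"
      then obtain U where "open U" "f y \<in> U" "f x \<notin> U"
        using t0_space by (metis hausdorff disjoint_iff)
      then obtain B where "B \<in> \<B>" "f y \<in> B" "f x \<notin> B"
        using topological_basisE[OF \<B>(2)] by (metis subsetD)
      then show False using elim x by blast
    qed
  qed
  then show ?thesis by blast
qed

text \<open>By \<open>eventually_constant\<close> the description always denotes, also for unbounded
  functions. The limit is attained on a large set, so its algebraic rules reduce to pointwise
  identities.\<close>

definition ulim :: "('a \<Rightarrow> complex) \<Rightarrow> complex" where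
  "ulim f = (THE c. eventually (\<lambda>x. f x = c) F)"

lemma ulim_eqI:
  assumes "eventually (\<lambda>x. f x = c) F"
  shows "ulim f = c"
  unfolding ulim_def
proof (rule the_equality)
  show "eventually (\<lambda>x. f x = c) F" by (rule assms)
next
  fix d assume "eventually (\<lambda>x. f x = d) F"
  with assms have "eventually (\<lambda>x. d = c) F"
    by eventually_elim simp
  then show "d = c" by (simp add: nontrivial)
qed

lemma eventually_ulim: "eventually (\<lambda>x. f x = ulim f) F"
  using eventually_constant[of f] ulim_eqI by metis

lemma ulim_add: "ulim (\<lambda>x. f x + g x) = ulim f + ulim g"
  by (rule ulim_eqI) (use eventually_ulim[of f] eventually_ulim[of g] in eventually_elim, simp)

lemma ulim_mult_left: "ulim (\<lambda>x. c * f x) = c * ulim f"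
  by (rule ulim_eqI) (use eventually_ulim[of f] in eventually_elim, simp)

lemma ulim_const: "ulim (\<lambda>x. c) = c"
  by (rule ulim_eqI) simp

text \<open>The limit is itself a value of \<open>f\<close> on a large set, so even a strict
  inequality passes to it.\<close>

lemma ulim_holds:
  assumes "eventually (\<lambda>x. P (f x)) F"
  shows "P (ulim f)"
proof -
  have "eventually (\<lambda>x. P (ulim f)) F"
    using assms eventually_ulim[of f] by eventually_elim simp
  then show ?thesis by (simp add: nontrivial)
qed

lemma ulim_eq_0_all:
  assumes "\<And>n::nat. ulim (f n) = 0"
  shows "eventually (\<lambda>x. \<forall>n. f n x = 0) F"
  by (rule all_nat) (metis assms eventually_ulim)

end

section \<open>From Ulam measures to ultrafilters\<close>

lemma ulam_measurable_ultrafilter: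
  assumes "ulam_measurable TYPE('a)"
  obtains F :: "'a filter" where "countably_complete_ultrafilter F"
proof -
  obtain \<mu> :: "'a set \<Rightarrow> real" where two: "\<And>A. \<mu> A = 0 \<or> \<mu> A = 1"
    and nonzero: "\<exists>A. \<mu> A \<noteq> 0" and sing: "\<And>x. \<mu> {x} = 0"
    and sums: "\<And>A :: nat \<Rightarrow> 'a set. disjoint_family A \<Longrightarrow> (\<lambda>n. \<mu> (A n)) sums \<mu> (\<Union>n. A n)"
    using assms unfolding ulam_measurable_def by auto
  \<comment> \<open>The empty sets form a disjoint family; a constant summable series must be
    zero.\<close>
  have "(\<lambda>n::nat. \<mu> {}) sums \<mu> {}"
    using sums[of "\<lambda>_. {}"] by (simp add: disjoint_family_on_def)
  then have empty: "\<mu> {} = 0"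
    using sums_summable summable_const_iff by blast
  have add: "\<mu> (A \<union> B) = \<mu> A + \<mu> B" if "A \<inter> B = {}" for A B
  proof -
    have "disjoint_family (binaryset A B)"
      using that by (auto simp: disjoint_family_on_def binaryset_def)
    then have "(\<lambda>n. \<mu> (binaryset A B n)) sums \<mu> (A \<union> B)"
      using sums[of "binaryset A B"] by (simp add: UN_binaryset_eq)
    moreover have "(\<lambda>n. \<mu> (binaryset A B n)) sums (\<mu> A + \<mu> B)"
      using empty by (rule binaryset_sums)
    ultimately show ?thesis by (rule sums_unique2)
  qed
  have mono: "\<mu> A \<le> \<mu> B" if "A \<subseteq> B" for A B
  proof -
    have "\<mu> B = \<mu> A + \<mu> (B - A)"
      using add[of A "B - A"] that by (simp add: Un_absorb1)
    then show ?thesis using two[of "B - A"] by auto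
  qed
  have null_subset: "\<mu> A = 0" if "A \<subseteq> B" "\<mu> B = 0" for A B
    using mono[OF that(1)] two[of A] that(2) by auto
  have null_UN: "\<mu> (\<Union>n. A n) = 0" if "\<And>n. \<mu> (A n) = 0" for A :: "nat \<Rightarrow> 'a set"
  proof -
    \<comment> \<open>Additivity speaks only of disjoint families, so the sets are first made
      disjoint; the pieces stay null as subsets.\<close>
    have "\<mu> (disjointed A n) = 0" for n
      using null_subset[OF disjointed_subset that] .
    then have "(\<lambda>n::nat. 0) sums \<mu> (\<Union>n. A n)"
      using sums[OF disjoint_family_disjointed, of A] by (simp add: UN_disjointed_eq)
    then show ?thesis using sums_unique2 sums_zero by blast
  qed
  have null_Un: "\<mu> (A \<union> B) = 0" if "\<mu> A = 0" "\<mu> B = 0" for A B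
    using null_UN[of "binaryset A B"] that empty
    by (simp add: UN_binaryset_eq) (simp add: binaryset_def)
  have compl: "\<mu> A + \<mu> (- A) = 1" for A
  proof -
    obtain B where "\<mu> B = 1" using nonzero two by blast
    then have "\<mu> UNIV = 1" using mono[of B UNIV] two[of UNIV] by auto
    then show ?thesis using add[of A "- A"] by (simp add: Compl_partition)
  qed
  define F where "F = Abs_filter (\<lambda>P. \<mu> {x. \<not> P x} = 0)"
  have "is_filter (\<lambda>P. \<mu> {x. \<not> P x} = 0)"
  proof
    fix P Q assume "\<mu> {x. \<not> P x} = 0" "\<mu> {x. \<not> Q x} = 0"
    then have "\<mu> ({x. \<not> P x} \<union> {x. \<not> Q x}) = 0" by (rule null_Un)
    then show "\<mu> {x. \<not> (P x \<and> Q x)} = 0"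
      by (rule null_subset[rotated]) auto
  next
    fix P Q :: "'a \<Rightarrow> bool" assume "\<forall>x. P x \<longrightarrow> Q x" "\<mu> {x. \<not> P x} = 0"
    then show "\<mu> {x. \<not> Q x} = 0"
      using null_subset[of "{x. \<not> Q x}" "{x. \<not> P x}"] by auto
  qed (simp add: empty)
  then have F: "eventually P F \<longleftrightarrow> \<mu> {x. \<not> P x} = 0" for P
    unfolding F_def by (rule eventually_Abs_filter)
  have "countably_complete_ultrafilter F"
  proof
    show "F \<noteq> bot"
      using compl[of UNIV] empty by (auto simp: trivial_limit_def F)
    show "eventually P F \<or> eventually (\<lambda>x. \<not> P x) F" for P
      using compl[of "{x. P x}"] two[of "{x. P x}"] by (auto simp: F Collect_neg_eq)
    show "eventually (\<lambda>x. \<forall>n. Q n x) F" if "\<And>n::nat. eventually (Q n) F" for Q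
    proof -
      have "{x. \<not> (\<forall>n. Q n x)} = (\<Union>n. {x. \<not> Q n x})" by auto
      then show ?thesis using null_UN[of "\<lambda>n. {x. \<not> Q n x}"] that by (simp add: F)
    qed
    show "eventually (\<lambda>x. x \<noteq> a) F" for a
      by (simp add: F sing)
  qed
  then show thesis by (rule that)
qed

section \<open>States on bounded functions\<close>

lemma linf_indicator: "(indicator A :: 'a \<Rightarrow> complex) \<in> linf"
  unfolding linf_def bounded_iff by (auto intro!: exI[of _ 1] simp: indicator_def)

lemma linf_proj_indicator: "linf_proj (indicator A :: 'a \<Rightarrow> complex)"
  unfolding linf_proj_def by (simp add: linf_indicator indicator_def)

lemma linf_proj_sup_indicator:
  "linf_proj_sup (\<lambda>n. indicator (A n)) (indicator (\<Union>n. A n) :: 'a \<Rightarrow> complex)"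
  unfolding linf_proj_sup_def linf_proj_le_def
  by (auto simp: linf_proj_indicator indicator_def split: if_splits)

text \<open>Positivity makes the values real, so \<open>Re\<close> loses nothing. Singularity kills
  the points, and regularity applies because the supremum of indicators is the indicator of the
  union.\<close>

lemma linf_state_null_sigma_charge:
  fixes \<phi> :: "('a \<Rightarrow> complex) \<Rightarrow> complex"
  assumes state: "linf_state \<phi>" and regular: "linf_regular \<phi>" and singular: "linf_singular \<phi>"
  shows "null_sigma_charge (\<lambda>A. Re (\<phi> (indicator A)))"
proof -
  have "cnonneg (indicator A i)" for A and i :: 'a
    by (simp add: cnonneg_def indicator_def)
  then have pos: "cnonneg (\<phi> (indicator A))" for A
    using state linf_indicator[of A] unfolding linf_state_def by blast
  then have null_iff: "Re (\<phi> (indicator A)) = 0 \<longleftrightarrow> \<phi> (indicator A) = 0" for A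
    unfolding cnonneg_def by (simp add: complex_eq_iff)
  show ?thesis
  proof
    show "0 \<le> Re (\<phi> (indicator A))" for A
      using pos[of A] by (simp add: cnonneg_def)
    have "(indicator UNIV :: 'a \<Rightarrow> complex) = (\<lambda>_. 1)" by auto
    then show "Re (\<phi> (indicator UNIV)) = 1"
      using state by (simp add: linf_state_def)
    show "Re (\<phi> (indicator (A \<union> B))) = Re (\<phi> (indicator A)) + Re (\<phi> (indicator B))"
      if "A \<inter> B = {}" for A B
    proof -
      have "(indicator (A \<union> B) :: 'a \<Rightarrow> complex) = (\<lambda>i. indicator A i + indicator B i)"
        using that by (auto simp: indicator_def fun_eq_iff)
      then show ?thesis
        using state linf_indicator[of A] linf_indicator[of B] by (simp add: linf_state_def)
    qed
    have "finite {i. (indicator {x} i :: complex) \<noteq> 0}" for x :: 'a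
      by (rule finite_subset[of _ "{x}"]) (auto simp: indicator_def)
    then show "Re (\<phi> (indicator {x})) = 0" for x
      using singular by (simp add: linf_singular_def)
    show "Re (\<phi> (indicator (\<Union>n. C n))) = 0" if "\<And>n::nat. Re (\<phi> (indicator (C n))) = 0" for C
      using regular[unfolded linf_regular_def, rule_format, OF linf_proj_indicator _
          linf_proj_sup_indicator[of C]] that
      by (simp add: null_iff)
  qed
qed

context countably_complete_ultrafilter
begin

lemma linf_state_ulim: "linf_state ulim"
  unfolding linf_state_def
  by (simp add: ulim_add ulim_mult_left ulim_const ulim_holds[of cnonneg])

lemma linf_singular_ulim: "linf_singular ulim"
  unfolding linf_singular_def
proof (intro allI impI)
  fix f :: "'a \<Rightarrow> complex" assume "finite {i. f i \<noteq> 0}"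
  then have "eventually (\<lambda>i. i \<notin> {i. f i \<noteq> 0}) F"
    by (intro not_in_countable countable_finite)
  then show "ulim f = 0" by (intro ulim_eqI) simp
qed

text \<open>Countable completeness gives one large set on which every \<open>q n\<close> vanishes.
  The supremum lies below the indicator \<open>R\<close> of the union of the supports, so it
  vanishes there as well.\<close>

lemma linf_regular_ulim: "linf_regular ulim"
  unfolding linf_regular_def
proof (intro allI impI)
  fix q :: "nat \<Rightarrow> 'a \<Rightarrow> complex" and P
  assume q: "\<forall>n. linf_proj (q n)" "\<forall>n. ulim (q n) = 0" and P: "linf_proj_sup q P"
  define R :: "'a \<Rightarrow> complex" where "R = indicator {i. \<exists>n. q n i \<noteq> 0}"
  have "linf_proj R" unfolding R_def by (rule linf_proj_indicator)
  moreover have "linf_proj_le (q n) R" for n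
    by (auto simp: linf_proj_le_def R_def indicator_def)
  ultimately have R: "R i * P i = P i" for i
    using P unfolding linf_proj_sup_def linf_proj_le_def by blast
  have "eventually (\<lambda>i. \<forall>n. q n i = 0) F"
    using q(2) by (intro ulim_eq_0_all) simp
  then have "eventually (\<lambda>i. P i = 0) F"
  proof eventually_elim
    case (elim i)
    then show ?case using R[of i] by (simp add: R_def)
  qed
  then show "ulim P = 0" by (rule ulim_eqI)
qed

end

section \<open>States on bounded operators\<close>

definition single :: "'a \<Rightarrow> complex \<Rightarrow> 'a \<Rightarrow> complex" where
  "single i c j = (if j = i then c else 0)"

text \<open>Multiplication by the indicator of \<open>A\<close>. The test \<open>x \<in> l2\<close>
  provides the value 0 outside \<open>l2\<close> that \<open>bop\<close> demands.\<close>

definition coord_proj :: "'a set \<Rightarrow> 'a op" where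
  "coord_proj A x i = (if x \<in> l2 \<and> i \<in> A then x i else 0)"

lemma l2_zero: "(\<lambda>_. 0) \<in> l2"
  by (simp add: l2_def)

lemma l2_add:
  assumes "x \<in> l2" "y \<in> l2"
  shows "(\<lambda>i. x i + y i) \<in> l2"
proof -
  have "(\<lambda>i. 2 * (cmod (x i))\<^sup>2 + 2 * (cmod (y i))\<^sup>2) summable_on UNIV"
    using assms by (intro summable_on_add summable_on_cmult_right) (auto simp: l2_def)
  moreover have "(cmod (x i + y i))\<^sup>2 \<le> 2 * (cmod (x i))\<^sup>2 + 2 * (cmod (y i))\<^sup>2" for i
  proof -
    have "(cmod (x i + y i))\<^sup>2 \<le> (cmod (x i) + cmod (y i))\<^sup>2"
      by (intro power_mono norm_triangle_ineq) simp
    also have "\<dots> \<le> 2 * (cmod (x i))\<^sup>2 + 2 * (cmod (y i))\<^sup>2"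
      using sum_squares_bound[of "cmod (x i)" "cmod (y i)"]
      by (simp add: power2_eq_square algebra_simps)
    finally show ?thesis .
  qed
  ultimately show ?thesis
    unfolding l2_def by (auto intro: summable_on_comparison_test)
qed

lemma l2_scale: "x \<in> l2 \<Longrightarrow> (\<lambda>i. c * x i) \<in> l2"
  by (simp add: l2_def norm_mult power_mult_distrib summable_on_cmult_right)

lemma l2_diff: "x \<in> l2 \<Longrightarrow> y \<in> l2 \<Longrightarrow> (\<lambda>i. x i - y i) \<in> l2"
  using l2_add[of x "\<lambda>i. (-1) * y i"] l2_scale[of y "-1"] by simp

lemma single_l2: "single i c \<in> l2"
proof -
  have "(\<lambda>j. (cmod (single i c j))\<^sup>2) summable_on {i}" by simp
  then show ?thesis
    unfolding l2_def mem_Collect_eq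
    by (rule summable_on_cong_neutral[THEN iffD1, rotated -1]) (auto simp: single_def)
qed

lemma l2_norm_single: "l2_norm (single i c) = cmod c"
proof -
  have "(\<Sum>\<^sub>\<infinity>j. (cmod (single i c j))\<^sup>2) = (\<Sum>\<^sub>\<infinity>j\<in>{i}. (cmod (single i c j))\<^sup>2)"
    by (rule infsum_cong_neutral) (auto simp: single_def)
  then show ?thesis by (simp add: l2_norm_def single_def)
qed

lemma l2_inner_single_left: "l2_inner (single i 1) x = x i"
proof -
  have "(\<Sum>\<^sub>\<infinity>j. cnj (single i 1 j) * x j) = (\<Sum>\<^sub>\<infinity>j\<in>{i}. cnj (single i 1 j) * x j)"
    by (rule infsum_cong_neutral) (auto simp: single_def)
  then show ?thesis by (simp add: l2_inner_def single_def)
qed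

lemma l2_inner_zero_left: "l2_inner (\<lambda>_. 0) x = 0"
  by (simp add: l2_inner_def)

lemma cmod_le_l2_norm:
  assumes "x \<in> l2"
  shows "cmod (x i) \<le> l2_norm x"
proof -
  have "(\<Sum>j\<in>{i}. (cmod (x j))\<^sup>2) \<le> (\<Sum>\<^sub>\<infinity>j. (cmod (x j))\<^sup>2)"
    using assms by (intro finite_sum_le_infsum) (auto simp: l2_def)
  then show ?thesis
    by (simp add: l2_norm_def real_le_rsqrt)
qed

lemma l2_inner_self:
  assumes "x \<in> l2"
  shows "l2_inner x x = of_real ((l2_norm x)\<^sup>2)"
proof -
  have "cnj (x i) * x i = of_real ((cmod (x i))\<^sup>2)" for i
    by (metis complex_norm_square mult.commute of_real_power)
  then have "l2_inner x x = (\<Sum>\<^sub>\<infinity>i. of_real ((cmod (x i))\<^sup>2))"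
    by (simp add: l2_inner_def)
  also have "\<dots> = of_real (\<Sum>\<^sub>\<infinity>i. (cmod (x i))\<^sup>2)"
    using assms by (intro infsumI has_sum_of_real has_sum_infsum) (simp add: l2_def)
  also have "(\<Sum>\<^sub>\<infinity>i. (cmod (x i))\<^sup>2) = (l2_norm x)\<^sup>2"
    by (simp add: l2_norm_def infsum_nonneg)
  finally show ?thesis .
qed

lemma l2_countable_support:
  assumes "x \<in> l2"
  shows "countable {i. x i \<noteq> 0}"
proof -
  have "countable {i \<in> UNIV. (cmod (x i))\<^sup>2 \<noteq> 0}"
    using assms by (intro Infinite_Sum.abs_summable_countable) (simp add: l2_def)
  then show ?thesis by simp
qed

section \<open>Coordinate projections\<close>

lemma coord_proj_l2: "coord_proj A x \<in> l2"
proof (cases "x \<in> l2")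
  case True
  then have "(\<lambda>i. (cmod (x i))\<^sup>2) summable_on UNIV" by (simp add: l2_def)
  then show ?thesis
    unfolding l2_def mem_Collect_eq
    by (rule summable_on_comparison_test) (auto simp: coord_proj_def)
next
  case False
  then have "coord_proj A x = (\<lambda>_. 0)" by (auto simp: coord_proj_def)
  then show ?thesis by (simp add: l2_zero)
qed

lemma coord_proj_bop: "coord_proj A \<in> bop"
proof -
  have "l2_norm (coord_proj A x) \<le> 1 * l2_norm x" if "x \<in> l2" for x
  proof -
    have "(\<Sum>\<^sub>\<infinity>i. (cmod (coord_proj A x i))\<^sup>2) \<le> (\<Sum>\<^sub>\<infinity>i. (cmod (x i))\<^sup>2)"
      using that coord_proj_l2[of A x] by (intro infsum_mono) (auto simp: l2_def coord_proj_def)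
    then show ?thesis by (simp add: l2_norm_def)
  qed
  then have "\<exists>K. \<forall>x\<in>l2. l2_norm (coord_proj A x) \<le> K * l2_norm x" by blast
  then show ?thesis
    unfolding bop_def mem_Collect_eq
    by (intro conjI) (auto simp: coord_proj_l2, auto simp: coord_proj_def l2_add l2_scale)
qed

lemma coord_proj_op_proj: "op_proj (coord_proj A)"
proof -
  have "coord_proj A \<circ> coord_proj A = coord_proj A"
    using coord_proj_l2[of A] by (auto simp: fun_eq_iff coord_proj_def[of A "coord_proj A _"])
      (auto simp: coord_proj_def)
  moreover have "l2_inner (coord_proj A x) y = l2_inner x (coord_proj A y)"
    if "x \<in> l2" "y \<in> l2" for x y
    unfolding l2_inner_def by (rule infsum_cong) (simp add: coord_proj_def that)
  ultimately show ?thesis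
    by (simp add: op_proj_def coord_proj_bop)
qed

lemma coord_proj_UNIV: "coord_proj UNIV = op_id"
  by (auto simp: coord_proj_def op_id_def fun_eq_iff)

lemma coord_proj_Un:
  "A \<inter> B = {} \<Longrightarrow> coord_proj (A \<union> B) = op_add (coord_proj A) (coord_proj B)"
  by (auto simp: coord_proj_def op_add_def fun_eq_iff)

lemma coord_proj_single: "i \<in> A \<Longrightarrow> coord_proj A (single i c) = single i c"
  by (auto simp: coord_proj_def single_l2 single_def fun_eq_iff)

text \<open>By symmetry and idempotence, the inner product of \<open>x\<close> with
  \<open>P x\<close> is the squared norm of \<open>P x\<close>.\<close>

lemma op_proj_positive:
  assumes "op_proj P"
  shows "op_positive P"
proof -
  have "l2_inner x (P x) = of_real ((l2_norm (P x))\<^sup>2)" if "x \<in> l2" for x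
  proof -
    have "P x \<in> l2" using assms that by (simp add: op_proj_def bop_def)
    then have "l2_inner (P x) (P x) = l2_inner x (P (P x))"
      using assms that by (simp add: op_proj_def)
    also have "P (P x) = P x" using assms by (metis comp_apply op_proj_def)
    finally show ?thesis using \<open>P x \<in> l2\<close> by (simp add: l2_inner_self)
  qed
  then show ?thesis
    using assms by (simp add: op_positive_def op_proj_def cnonneg_def)
qed

text \<open>Taking a coordinate is pairing with a basis vector, and symmetry moves \<open>P\<close>
  onto that vector.\<close>

lemma op_proj_symmetric:
  assumes "op_proj P" "x \<in> l2"
  shows "P x i = l2_inner (P (single i 1)) x"
  using assms l2_inner_single_left[of i "P x"] by (simp add: op_proj_def single_l2)

text \<open>The unit ball is mapped into the multiples of one basis vector with coefficients in the
  closed unit disc, so a finite net of the disc gives one of the image.\<close>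

lemma coord_proj_singleton_compact: "op_compact (coord_proj {i})"
  unfolding op_compact_def
proof (intro conjI allI impI coord_proj_bop)
  fix e :: real assume "e > 0"
  then obtain K where K: "finite K" "cball (0 :: complex) 1 \<subseteq> (\<Union>c\<in>K. ball c e)"
    using compact_cball[of "0 :: complex" 1] unfolding compact_eq_totally_bounded by blast
  show "\<exists>G. finite G \<and> G \<subseteq> l2 \<and>
      (\<forall>x\<in>l2. l2_norm x \<le> 1 \<longrightarrow> (\<exists>y\<in>G. l2_norm (\<lambda>j. coord_proj {i} x j - y j) < e))"
  proof (intro exI conjI ballI impI)
    show "finite (single i ` K)" using K by simp
    show "single i ` K \<subseteq> l2" by (auto simp: single_l2)
    fix x :: "'a \<Rightarrow> complex" assume x: "x \<in> l2" "l2_norm x \<le> 1"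
    then have "x i \<in> cball 0 1" using cmod_le_l2_norm[of x i] by simp
    then obtain c where c: "c \<in> K" "dist c (x i) < e" using K by auto
    have "(\<lambda>j. coord_proj {i} x j - single i c j) = single i (x i - c)"
      using x by (auto simp: coord_proj_def single_def fun_eq_iff)
    then have "l2_norm (\<lambda>j. coord_proj {i} x j - single i c j) < e"
      using c by (simp add: l2_norm_single dist_norm norm_minus_commute)
    with c show "\<exists>y\<in>single i ` K. l2_norm (\<lambda>j. coord_proj {i} x j - y j) < e" by blast
  qed
qed

text \<open>For minimality, an upper bound \<open>R\<close> fixes the basis vectors indexed by the
  union. Symmetry of \<open>R\<close> extends this, coordinate by coordinate, to all vectors
  supported there, with no limit argument.\<close>

lemma op_proj_sup_coord_proj: "op_proj_sup (\<lambda>n. coord_proj (A n)) (coord_proj (\<Union>n. A n))"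
  unfolding op_proj_sup_def
proof (intro conjI allI impI coord_proj_op_proj)
  show "op_proj_le (coord_proj (A n)) (coord_proj (\<Union>n. A n))" for n
    using coord_proj_l2[of "A n"]
    by (auto simp: op_proj_le_def fun_eq_iff coord_proj_def[of "\<Union>n. A n"])
      (auto simp: coord_proj_def)
  fix R :: "'a op" assume R: "op_proj R" and le: "\<forall>n. op_proj_le (coord_proj (A n)) R"
  have fix_single: "R (single i 1) = single i 1" if "i \<in> A n" for i n
    using le coord_proj_single[OF that, of 1] by (metis comp_apply op_proj_le_def)
  have "R (coord_proj (\<Union>n. A n) x) j = coord_proj (\<Union>n. A n) x j" for x j
  proof -
    let ?y = "coord_proj (\<Union>n. A n) x"
    \<comment> \<open>Off the union \<open>?y\<close> vanishes; on it, entry \<open>i\<close> of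
      column \<open>j\<close> of \<open>R\<close> is read off the fixed vector
      \<open>single i 1\<close>.\<close>
    have "cnj (R (single j 1) i) * ?y i = cnj (single j 1 i) * ?y i" for i
    proof (cases "i \<in> (\<Union>n. A n)")
      case True
      then have "R (single j 1) i = single j 1 i"
        using op_proj_symmetric[OF R single_l2, of j 1 i] fix_single
        by (auto simp: l2_inner_single_left)
      then show ?thesis by simp
    qed (simp add: coord_proj_def)
    then have "l2_inner (R (single j 1)) ?y = l2_inner (single j 1) ?y"
      unfolding l2_inner_def by (rule infsum_cong)
    then show ?thesis
      using op_proj_symmetric[OF R coord_proj_l2] by (simp add: l2_inner_single_left)
  qed
  then show "op_proj_le (coord_proj (\<Union>n. A n)) R"
    by (simp add: op_proj_le_def fun_eq_iff)
qed

text \<open>Only the diagonal projections matter: their suprema among all projections are again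
  diagonal, so regularity applies, and those of rank one are compact, so points are null.\<close>

lemma bop_state_null_sigma_charge:
  fixes \<phi> :: "'a op \<Rightarrow> complex"
  assumes state: "bop_state \<phi>" and regular: "bop_regular \<phi>" and singular: "bop_singular \<phi>"
  shows "null_sigma_charge (\<lambda>A. Re (\<phi> (coord_proj A)))"
proof -
  have pos: "cnonneg (\<phi> (coord_proj A))" for A
    using state op_proj_positive[OF coord_proj_op_proj[of A]] unfolding bop_state_def by blast
  then have null_iff: "Re (\<phi> (coord_proj A)) = 0 \<longleftrightarrow> \<phi> (coord_proj A) = 0" for A
    unfolding cnonneg_def by (simp add: complex_eq_iff)
  show ?thesis
  proof
    show "0 \<le> Re (\<phi> (coord_proj A))" for A
      using pos[of A] by (simp add: cnonneg_def)
    show "Re (\<phi> (coord_proj UNIV)) = 1"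
      using state by (simp add: bop_state_def coord_proj_UNIV)
    show "Re (\<phi> (coord_proj (A \<union> B))) = Re (\<phi> (coord_proj A)) + Re (\<phi> (coord_proj B))"
      if "A \<inter> B = {}" for A B
      using state coord_proj_bop[of A] coord_proj_bop[of B]
      by (simp add: bop_state_def coord_proj_Un[OF that])
    show "Re (\<phi> (coord_proj {x})) = 0" for x
      using singular coord_proj_singleton_compact[of x] by (simp add: bop_singular_def)
    show "Re (\<phi> (coord_proj (\<Union>n. C n))) = 0" if "\<And>n::nat. Re (\<phi> (coord_proj (C n))) = 0" for C
      using regular[unfolded bop_regular_def, rule_format, OF coord_proj_op_proj _
          op_proj_sup_coord_proj[of C]] that
      by (simp add: null_iff)
  qed
qed

section \<open>The limit of the diagonal entries as a state\<close>

context countably_complete_ultrafilter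
begin

definition diag_ulim :: "'a op \<Rightarrow> complex" where
  "diag_ulim T = ulim (\<lambda>i. T (single i 1) i)"

lemma bop_state_diag_ulim: "bop_state diag_ulim"
proof -
  have "cnonneg (diag_ulim T)" if "op_positive T" for T
  proof -
    have "cnonneg (T (single i 1) i)" for i
      using that l2_inner_single_left[of i "T (single i 1)"] single_l2[of i 1]
      by (metis op_positive_def)
    then show ?thesis unfolding diag_ulim_def by (simp add: ulim_holds[of cnonneg])
  qed
  moreover have "diag_ulim op_id = 1"
    by (simp add: diag_ulim_def op_id_def single_l2) (simp add: single_def ulim_const)
  ultimately show ?thesis
    by (simp add: bop_state_def diag_ulim_def op_add_def op_scale_def ulim_add ulim_mult_left)
qed

text \<open>The members of a finite \<open>e\<close>-net for the image of the unit ball have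
  countable support, so almost every \<open>i\<close> avoids all these supports. There
  \<open>T (single i 1)\<close> is within \<open>e\<close> of a vector whose entry at
  \<open>i\<close> is 0.\<close>

lemma bop_singular_diag_ulim: "bop_singular diag_ulim"
  unfolding bop_singular_def
proof (intro allI impI)
  fix T :: "'a op" assume T: "op_compact T"
  have "cmod (diag_ulim T) < e" if "e > 0" for e
  proof -
    obtain K where K: "finite K" "K \<subseteq> l2"
      "\<And>x. x \<in> l2 \<Longrightarrow> l2_norm x \<le> 1 \<Longrightarrow> \<exists>y\<in>K. l2_norm (\<lambda>i. T x i - y i) < e"
      using T \<open>e > 0\<close> unfolding op_compact_def by meson
    have "countable (\<Union>y\<in>K. {i. y i \<noteq> 0})"
      using K l2_countable_support by (intro countable_UN countable_finite[of K]) auto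
    then have "eventually (\<lambda>i. i \<notin> (\<Union>y\<in>K. {i. y i \<noteq> 0})) F"
      by (rule not_in_countable)
    then have "eventually (\<lambda>i. cmod (T (single i 1) i) < e) F"
    proof eventually_elim
      case (elim i)
      obtain y where y: "y \<in> K" "l2_norm (\<lambda>j. T (single i 1) j - y j) < e"
        using K(3)[of "single i 1"] by (auto simp: single_l2 l2_norm_single)
      have "T (single i 1) \<in> l2"
        using T single_l2[of i 1] by (simp add: op_compact_def bop_def)
      then have "(\<lambda>j. T (single i 1) j - y j) \<in> l2"
        using y K by (intro l2_diff) auto
      from cmod_le_l2_norm[OF this, of i] show ?case
        using y elim by auto
    qed
    then show ?thesis unfolding diag_ulim_def by (rule ulim_holds[of "\<lambda>z. cmod z < e"])
  qed
  then show "diag_ulim T = 0"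
    by (metis less_irrefl zero_less_norm_iff)
qed

lemma bop_regular_diag_ulim: "bop_regular diag_ulim"
  unfolding bop_regular_def
proof (intro allI impI)
  fix q :: "nat \<Rightarrow> 'a op" and P
  assume q: "\<forall>n. op_proj (q n)" "\<forall>n. diag_ulim (q n) = 0" and P: "op_proj_sup q P"
  have "eventually (\<lambda>i. \<forall>n. q n (single i 1) i = 0) F"
    using q(2) by (intro ulim_eq_0_all) (simp add: diag_ulim_def)
  then have "eventually (\<lambda>i. P (single i 1) i = 0) F"
  proof eventually_elim
    case (elim i)
    \<comment> \<open>The projection onto the orthogonal complement of \<open>single i 1\<close>. It
      bounds every \<open>q n\<close>, hence also \<open>P\<close>.\<close>
    let ?R = "coord_proj (- {i})"
    \<comment> \<open>The diagonal entry of a projection at \<open>i\<close> is the squared norm of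
      the image of \<open>single i 1\<close>, so a zero entry kills the whole column.\<close>
    have zero: "q n (single i 1) = (\<lambda>_. 0)" for n
    proof
      fix j
      let ?y = "q n (single i 1)"
      have y: "?y \<in> l2" and "q n ?y = ?y"
        using q(1) single_l2[of i 1] by (simp add: op_proj_def bop_def, metis comp_apply op_proj_def)
      then have "l2_inner ?y ?y = ?y i"
        using op_proj_symmetric[of "q n" ?y i] q(1) by simp
      then have "l2_norm ?y = 0"
        using elim y by (simp add: l2_inner_self)
      then show "?y j = 0"
        using cmod_le_l2_norm[OF y, of j] by simp
    qed
    have "op_proj_le (q n) ?R" for n
      unfolding op_proj_le_def
    proof (intro ext)
      fix x j
      show "(?R \<circ> q n) x j = q n x j"
      proof (cases "x \<in> l2")
        case True
        then have "q n x \<in> l2" using q(1) by (simp add: op_proj_def bop_def)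
        \<comment> \<open>By symmetry, killing \<open>single i 1\<close> means that the range of
          \<open>q n\<close> is orthogonal to it.\<close>
        moreover have "q n x i = 0"
          using op_proj_symmetric[OF q(1)[rule_format] True, of n i]
          by (simp add: zero l2_inner_zero_left)
        ultimately show ?thesis by (auto simp: coord_proj_def)
      next
        case False
        then have "q n x = (\<lambda>_. 0)" using q(1) by (simp add: op_proj_def bop_def)
        then show ?thesis by (simp add: coord_proj_def)
      qed
    qed
    then have "?R \<circ> P = P"
      using P coord_proj_op_proj unfolding op_proj_sup_def op_proj_le_def by blast
    then have "P (single i 1) i = ?R (P (single i 1)) i" by (metis comp_apply)
    then show ?case by (simp add: coord_proj_def)
  qed
  then show "diag_ulim P = 0"
    unfolding diag_ulim_def by (rule ulim_eqI)
qed

end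

theorem theorem8p4:
  assumes CH: "continuum_hypothesis"
    and inf: "infinite (UNIV :: 'a set)"
  shows "((\<exists>\<phi> :: ('a \<Rightarrow> complex) \<Rightarrow> complex.
              linf_state \<phi> \<and> linf_regular \<phi> \<and> linf_singular \<phi>)
            \<longleftrightarrow> ulam_measurable TYPE('a))
       \<and> ((\<exists>\<phi> :: 'a op \<Rightarrow> complex.
              bop_state \<phi> \<and> bop_regular \<phi> \<and> bop_singular \<phi>)
            \<longleftrightarrow> ulam_measurable TYPE('a))"
proof (intro conjI iffI)
  assume "\<exists>\<phi> :: ('a \<Rightarrow> complex) \<Rightarrow> complex. linf_state \<phi> \<and> linf_regular \<phi> \<and> linf_singular \<phi>"
  then show "ulam_measurable TYPE('a)"
    using linf_state_null_sigma_charge CH null_sigma_charge.continuum_hypothesis_imp_ulam_measurable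
    by blast
next
  assume "\<exists>\<phi> :: 'a op \<Rightarrow> complex. bop_state \<phi> \<and> bop_regular \<phi> \<and> bop_singular \<phi>"
  then show "ulam_measurable TYPE('a)"
    using bop_state_null_sigma_charge CH null_sigma_charge.continuum_hypothesis_imp_ulam_measurable
    by blast
next
  assume "ulam_measurable TYPE('a)"
  then obtain F :: "'a filter" where "countably_complete_ultrafilter F"
    by (rule ulam_measurable_ultrafilter)
  then interpret countably_complete_ultrafilter F .
  show "\<exists>\<phi> :: ('a \<Rightarrow> complex) \<Rightarrow> complex. linf_state \<phi> \<and> linf_regular \<phi> \<and> linf_singular \<phi>"
    using linf_state_ulim linf_regular_ulim linf_singular_ulim by blast
  show "\<exists>\<phi> :: 'a op \<Rightarrow> complex. bop_state \<phi> \<and> bop_regular \<phi> \<and> bop_singular \<phi>"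
    using bop_state_diag_ulim bop_regular_diag_ulim bop_singular_diag_ulim by blast
qed

end
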